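(* Consider the semistable system $\dot x(t)=Ax(t)+Bu(t)$, $y(t)=Cx(t)$, with $A\in\mathbb{R}^{n\times n}$, $B\in\mathbb{R}^{n\times p}$, $C\in\mathbb{R}^{q\times n}$, let $\mathcal{J}=\lim_{\tau\to\infty}e^{A\tau}$, and let $\mathcal{P},\mathcal{Q}\in\mathbb{R}^{n\times n}$ be its pseudo controllability and pseudo observability Gramians. Then $\mathcal{P}$ is the unique symmetric solution of the set of equations $$0=A\mathcal{P}+\mathcal{P}A^\top+(I-\mathcal{J})BB^\top(I-\mathcal{J}^\top),\qquad 0=\mathcal{J}\mathcal{P}\mathcal{J}^\top,$$ and $\mathcal{Q}$ is the unique symmetric solution of the set of equations $$0=A^\top\mathcal{Q}+\mathcal{Q}A+(I-\mathcal{J}^\top)C^\top C(I-\mathcal{J}),\qquad 0=\mathcal{J}^\top\mathcal{Q}\mathcal{J}.$$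
   Context: The system $\dot x=Ax+Bu$, $y=Cx$ (states $x\in\mathbb{R}^n$, inputs $u\in\mathbb{R}^p$, outputs $y\in\mathbb{R}^q$) is called semistable if $\lim_{t\to\infty}x(t)$ exists for all initial states $x(0)$ when $u=0$. For a semistable system, $\mathcal{J}:=\lim_{\tau\to\infty}e^{A\tau}$ is a constant matrix, and the pseudo controllability and observability Gramians are defined by $$\mathcal{P}=\int_0^\infty(e^{A\tau}-\mathcal{J})BB^\top(e^{A^\top\tau}-\mathcal{J}^\top)\,d\tau,\qquad \mathcal{Q}=\int_0^\infty(e^{A^\top\tau}-\mathcal{J}^\top)C^\top C(e^{A\tau}-\mathcal{J})\,d\tau .$$ *)

theory Defs
  imports "HOL-Analysis.Analysis"
begin

text \<open>The class operations for multiplication, unit and power act entrywise on the type of square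
  matrices, and the library exponential does not apply to it; matrix power and exponential are built from
  the matrix product and its unit.\<close>

definition matrix_power :: "real^'n^'n \<Rightarrow> nat \<Rightarrow> real^'n^'n" where
  "matrix_power A k = (((**) A) ^^ k) (mat 1)"

definition matrix_exp :: "real^'n^'n \<Rightarrow> real^'n^'n" where
  "matrix_exp A = (\<Sum>k. (1 / fact k) *\<^sub>R matrix_power A k)"

definition state_trajectory ::
    "real^'n^'n \<Rightarrow> real^'p^'n \<Rightarrow> (real \<Rightarrow> real^'p) \<Rightarrow> (real \<Rightarrow> real^'n) \<Rightarrow> bool" where
  "state_trajectory A B u x \<longleftrightarrow>
     (\<forall>t\<ge>0. (x has_vector_derivative (A *v x t + B *v u t)) (at t within {0..}))"

definition semistable :: "real^'n^'n \<Rightarrow> real^'p^'n \<Rightarrow> bool" where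
  "semistable A B \<longleftrightarrow>
     (\<forall>x0 x. state_trajectory A B (\<lambda>_. 0) x \<and> x 0 = x0 \<longrightarrow> (\<exists>l. (x \<longlongrightarrow> l) at_top))"

definition limit_matrix :: "real^'n^'n \<Rightarrow> real^'n^'n" where
  "limit_matrix A = Lim at_top (\<lambda>\<tau>::real. matrix_exp (\<tau> *\<^sub>R A))"

text \<open>The integrals are Henstock--Kurzweil integrals over the half-line, which include
  convergent improper integrals.\<close>

definition pseudo_controllability_gramian ::
    "real^'n^'n \<Rightarrow> real^'p^'n \<Rightarrow> real^'n^'n" where
  "pseudo_controllability_gramian A B = integral {0..} (\<lambda>\<tau>::real.
     (matrix_exp (\<tau> *\<^sub>R A) - limit_matrix A) ** B ** transpose B **
     (matrix_exp (\<tau> *\<^sub>R transpose A) - transpose (limit_matrix A)))"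

definition pseudo_observability_gramian ::
    "real^'n^'n \<Rightarrow> real^'n^'q \<Rightarrow> real^'n^'n" where
  "pseudo_observability_gramian A C = integral {0..} (\<lambda>\<tau>::real.
     (matrix_exp (\<tau> *\<^sub>R transpose A) - transpose (limit_matrix A)) ** transpose C ** C **
     (matrix_exp (\<tau> *\<^sub>R A) - limit_matrix A))"

definition controllability_equations ::
    "real^'n^'n \<Rightarrow> real^'p^'n \<Rightarrow> real^'n^'n \<Rightarrow> real^'n^'n \<Rightarrow> bool" where
  "controllability_equations A B J X \<longleftrightarrow>
     0 = A ** X + X ** transpose A
         + (mat 1 - J) ** B ** transpose B ** (mat 1 - transpose J) \<and>
     0 = J ** X ** transpose J"

definition observability_equations ::
    "real^'n^'n \<Rightarrow> real^'n^'q \<Rightarrow> real^'n^'n \<Rightarrow> real^'n^'n \<Rightarrow> bool" where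
  "observability_equations A C J X \<longleftrightarrow>
     0 = transpose A ** X + X ** A
         + (mat 1 - transpose J) ** transpose C ** C ** (mat 1 - J) \<and>
     0 = transpose J ** X ** J"

end

theory Submission
  imports Defs
begin

text \<open>Semistability makes \<open>F t = e\<^sup>A\<^sup>t - J\<close> tend to \<open>0\<close>. Since \<open>J\<close> is idempotent and absorbs
  \<open>e\<^sup>A\<^sup>t\<close>, also \<open>F (s + t) = F s F t\<close>, so the decay is exponential and the Gramian integrals
  converge. As \<open>A J = 0\<close>, the integrand \<open>M t = F t B B\<^sup>T (F t)\<^sup>T\<close> satisfies \<open>M' = A M + M A\<^sup>T\<close>;
  integrating from \<open>0\<close> to infinity yields the Lyapunov equation, and \<open>J F t = 0\<close> the
  side condition. If \<open>D\<close> is the difference of two solutions, \<open>e\<^sup>A\<^sup>t D (e\<^sup>A\<^sup>t)\<^sup>T\<close> is constant with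
  value \<open>D\<close> at \<open>0\<close> and limit \<open>J D J\<^sup>T = 0\<close>. The observability half is the controllability half for
  the transposed system.\<close>

section \<open>Matrix product and transposition as continuous operations\<close>

lemma bounded_bilinear_matrix_matrix_mult:
  "bounded_bilinear ((**) :: real^'n^'m \<Rightarrow> real^'p^'n \<Rightarrow> real^'p^'m)"
  unfolding bilinear_conv_bounded_bilinear[symmetric] bilinear_def linear_iff
  by (simp add: matrix_add_ldistrib matrix_matrix_mult_def vec_eq_iff
      sum.distrib sum_distrib_left algebra_simps)

text \<open>The class product is entrywise, so the rules for limits, derivatives and signs of
  products are obtained for \<open>**\<close> from its bilinearity.\<close>

interpretation matrix_mult: bounded_bilinear
  "(**) :: real^'n^'m \<Rightarrow> real^'p^'n \<Rightarrow> real^'p^'m"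
  by (rule bounded_bilinear_matrix_matrix_mult)

lemma bounded_linear_transpose:
  "bounded_linear (transpose :: real^'n^'m \<Rightarrow> real^'m^'n)"
  by (intro linear_conv_bounded_linear[THEN iffD1] linearI)
     (simp_all add: transpose_def vec_eq_iff)

lemma transpose_diff: "transpose (X - Y) = transpose X - transpose (Y :: real^'n^'m)"
  by (simp add: bounded_linear.linear[OF bounded_linear_transpose] linear_diff)

section \<open>The matrix exponential\<close>

lemma matrix_power_0: "matrix_power A 0 = mat 1"
  by (simp add: matrix_power_def)

lemma matrix_power_Suc: "matrix_power A (Suc k) = A ** matrix_power A k"
  by (simp add: matrix_power_def)

lemma matrix_power_commute: "matrix_power A k ** A = A ** matrix_power A k"
  by (induction k) (simp_all add: matrix_power_0 matrix_power_Suc flip: matrix_mul_assoc)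

lemma matrix_power_scaleR: "matrix_power (t *\<^sub>R A) k = t ^ k *\<^sub>R matrix_power A k"
  by (induction k)
     (simp_all add: matrix_power_0 matrix_power_Suc matrix_mult.scaleR_left matrix_mult.scaleR_right)

lemma transpose_matrix_power: "transpose (matrix_power A k) = matrix_power (transpose A) k"
  by (induction k)
     (simp_all add: matrix_power_0 matrix_power_Suc matrix_transpose_mul matrix_power_commute)

text \<open>Powers of \<open>A\<close> grow at most geometrically, with ratio
  \<open>norm A * K\<close>, so a scalar exponential series dominates. This gives the
  \<open>suminf\<close> in \<open>matrix_exp\<close> its meaning.\<close>

lemma matrix_exp_sums:
  fixes A :: "real^'n^'n"
  shows "(\<lambda>k. (1 / fact k) *\<^sub>R matrix_power A k) sums matrix_exp A"
proof -
  obtain K where K: "0 < K"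
    "\<And>(X :: real^'n^'n) (Y :: real^'n^'n). norm (X ** Y) \<le> norm X * norm Y * K"
    using matrix_mult.pos_bounded by blast
  have bound: "norm (matrix_power A k) \<le> norm (mat 1 :: real^'n^'n) * (norm A * K) ^ k" for k
  proof (induction k)
    case (Suc k)
    have "norm (matrix_power A (Suc k)) \<le> (norm A * K) * norm (matrix_power A k)"
      using K(2)[of A "matrix_power A k"] by (simp add: matrix_power_Suc mult_ac)
    also have "\<dots> \<le> (norm A * K) * (norm (mat 1 :: real^'n^'n) * (norm A * K) ^ k)"
      using K(1) Suc by (intro mult_left_mono) auto
    finally show ?case by (simp add: mult_ac)
  qed (simp add: matrix_power_0)
  have "summable (\<lambda>k. (1 / fact k) *\<^sub>R matrix_power A k)"
  proof (rule summable_comparison_test)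
    show "\<exists>N. \<forall>k\<ge>N. norm ((1 / fact k) *\<^sub>R matrix_power A k)
        \<le> norm (mat 1 :: real^'n^'n) * (inverse (fact k) * (norm A * K) ^ k)"
      using bound by (auto simp: divide_simps mult_ac)
    show "summable (\<lambda>k. norm (mat 1 :: real^'n^'n) * (inverse (fact k) * (norm A * K) ^ k))"
      by (intro summable_mult summable_exp)
  qed
  then show ?thesis
    by (simp add: matrix_exp_def summable_sums)
qed

lemma matrix_exp_scaleR_sums:
  "(\<lambda>k. (t ^ k / fact k) *\<^sub>R matrix_power A k) sums matrix_exp (t *\<^sub>R A)"
  using matrix_exp_sums[of "t *\<^sub>R A"] by (simp add: matrix_power_scaleR)

lemma matrix_exp_0: "matrix_exp 0 = mat 1"
proof -
  have eq: "(1 / fact k) *\<^sub>R matrix_power 0 k = (if k = 0 then mat 1 else 0 :: real^'n^'n)" for k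
    by (cases k) (simp_all add: matrix_power_0 matrix_power_Suc)
  then have "(\<lambda>k. if k = 0 then mat 1 else 0) sums matrix_exp (0 :: real^'n^'n)"
    using matrix_exp_sums[of "0 :: real^'n^'n"] by (simp only: eq)
  then show ?thesis
    using sums_single[of 0 "\<lambda>_. mat 1 :: real^'n^'n"] sums_unique2 by blast
qed

lemma matrix_exp_transpose: "matrix_exp (transpose A) = transpose (matrix_exp A)"
  using bounded_linear.sums[OF bounded_linear_transpose matrix_exp_sums[of A]]
    matrix_exp_sums[of "transpose A"]
  by (simp add: transpose_scalar transpose_matrix_power sums_unique2)

lemma matrix_exp_commute: "matrix_exp (t *\<^sub>R A) ** A = A ** matrix_exp (t *\<^sub>R A)"
  using bounded_linear.sums[OF matrix_mult.bounded_linear_left matrix_exp_scaleR_sums[of t A], of A]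
    bounded_linear.sums[OF matrix_mult.bounded_linear_right matrix_exp_scaleR_sums[of t A], of A]
  by (simp add: matrix_mult.scaleR_left matrix_mult.scaleR_right matrix_power_commute sums_unique2)

text \<open>Each coordinate of the exponential is a scalar power series in \<open>t\<close>
  converging everywhere, hence differentiable term by term.\<close>

lemma has_vector_derivative_matrix_exp:
  fixes A :: "real^'n^'n"
  shows "((\<lambda>t. matrix_exp (t *\<^sub>R A)) has_vector_derivative A ** matrix_exp (t *\<^sub>R A)) (at t within S)"
  unfolding has_vector_derivative_def
proof (subst has_derivative_componentwise_within, intro ballI)
  fix b :: "real^'n^'n"
  define c where "c k = (matrix_power A k \<bullet> b) / fact k" for k
  have c: "(\<lambda>k. c k * s ^ k) sums (matrix_exp (s *\<^sub>R A) \<bullet> b)" for s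
    using bounded_linear.sums[OF bounded_linear_inner_left matrix_exp_scaleR_sums[of s A], of b]
    by (simp add: c_def mult_ac)
  \<comment> \<open>\<open>diffs\<close> shifts the index: the factor \<open>Suc k\<close> turns
    \<open>fact (Suc k)\<close> into \<open>fact k\<close>, and the extra power of \<open>A\<close>
    is split off on the left.\<close>
  have "diffs c k * t ^ k = ((t ^ k / fact k) *\<^sub>R (A ** matrix_power A k)) \<bullet> b" for k
    by (simp add: diffs_def c_def matrix_power_Suc field_simps del: of_nat_Suc)
  moreover have "(\<lambda>k. ((t ^ k / fact k) *\<^sub>R (A ** matrix_power A k)) \<bullet> b) sums
      ((A ** matrix_exp (t *\<^sub>R A)) \<bullet> b)"
    using bounded_linear.sums[OF bounded_linear_inner_left
        bounded_linear.sums[OF matrix_mult.bounded_linear_right matrix_exp_scaleR_sums[of t A]],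
        of A b]
    by (simp add: matrix_mult.scaleR_right)
  ultimately have d: "(\<Sum>k. diffs c k * t ^ k) = (A ** matrix_exp (t *\<^sub>R A)) \<bullet> b"
    by (simp add: sums_iff)
  have "((\<lambda>s. \<Sum>k. c k * s ^ k) has_real_derivative (\<Sum>k. diffs c k * t ^ k)) (at t)"
    using c by (intro termdiffs_strong_converges_everywhere) (simp add: sums_iff)
  then have "((\<lambda>s. matrix_exp (s *\<^sub>R A) \<bullet> b) has_real_derivative
      (A ** matrix_exp (t *\<^sub>R A)) \<bullet> b) (at t within S)"
    using c d by (simp add: sums_iff has_field_derivative_at_within)
  then show "((\<lambda>s. matrix_exp (s *\<^sub>R A) \<bullet> b) has_derivative
      (\<lambda>h. (h *\<^sub>R (A ** matrix_exp (t *\<^sub>R A))) \<bullet> b)) (at t within S)"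
    by (simp add: has_field_derivative_def mult.commute[of _ "_ \<bullet> _"])
qed

lemma continuous_on_matrix_exp: "continuous_on S (\<lambda>t. matrix_exp (t *\<^sub>R A))"
  unfolding continuous_on_eq_continuous_within
  using has_vector_derivative_continuous[OF has_vector_derivative_matrix_exp] by blast

text \<open>For fixed \<open>t\<close> the product of the exponentials at \<open>- s\<close> and
  \<open>s + t\<close> has derivative zero in \<open>s\<close>, so it keeps its value at
  \<open>s = 0\<close>.\<close>

lemma matrix_exp_add: "matrix_exp ((s + t) *\<^sub>R A) = matrix_exp (s *\<^sub>R A) ** matrix_exp (t *\<^sub>R A)"
proof -
  have const: "matrix_exp (- s *\<^sub>R A) ** matrix_exp ((s + t) *\<^sub>R A) = matrix_exp (t *\<^sub>R A)" for s t
  proof -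
    define g where "g s = matrix_exp (s *\<^sub>R (- A)) ** matrix_exp ((s + t) *\<^sub>R A)" for s
    have "(g has_vector_derivative 0) (at s)" for s
    proof -
      have "((\<lambda>s. matrix_exp ((s + t) *\<^sub>R A)) has_vector_derivative
          A ** matrix_exp ((s + t) *\<^sub>R A)) (at s)"
        using vector_diff_chain_at[of "\<lambda>s. s + t" 1 s, OF _ has_vector_derivative_matrix_exp[of A]]
        by (simp add: o_def has_vector_derivative_add_const has_vector_derivative_id)
      from matrix_mult.has_vector_derivative[OF has_vector_derivative_matrix_exp this, of "- A"]
      have "(g has_vector_derivative
          matrix_exp (s *\<^sub>R (- A)) ** (A ** matrix_exp ((s + t) *\<^sub>R A))
          + (- A ** matrix_exp (s *\<^sub>R (- A))) ** matrix_exp ((s + t) *\<^sub>R A)) (at s)"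
        unfolding g_def .
      \<comment> \<open>Moving \<open>A\<close> across the first factor makes the two terms of the
        product rule cancel.\<close>
      also have "- A ** matrix_exp (s *\<^sub>R (- A)) = - (matrix_exp (s *\<^sub>R (- A)) ** A)"
        using matrix_exp_commute[of s "- A"] by (simp add: matrix_mult.minus_right)
      finally show ?thesis
        by (simp add: matrix_mul_assoc matrix_mult.minus_left)
    qed
    then obtain c where "\<And>s. g s = c"
      using has_vector_derivative_zero_constant[of UNIV g] by auto
    then have "g s = g 0" by simp
    then show ?thesis by (simp add: g_def matrix_exp_0)
  qed
  \<comment> \<open>The case \<open>t = 0\<close> of \<open>const\<close> makes the exponential
    invertible; multiplying \<open>const\<close> by it from the left gives the addition law.\<close>
  have "matrix_exp (s *\<^sub>R A) ** matrix_exp (- s *\<^sub>R A) = mat 1"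
    using const[of "- s" 0] const[of "- s" s] by (simp add: matrix_exp_0)
  then show ?thesis
    using const[of s t] by (metis matrix_mul_assoc matrix_mul_lid)
qed

section \<open>Exponential decay and integrals over the half-line\<close>

text \<open>Once \<open>F T\<close> is small enough, each further step of length \<open>T\<close>
  shrinks the norm by a factor \<open>exp (- 1)\<close>, and compactness bounds \<open>F\<close> on
  the first period. In the application \<open>F 0\<close> is \<open>mat 1 - J\<close>.\<close>

lemma matrix_semigroup_exponential_decay:
  fixes F :: "real \<Rightarrow> real^'n^'n"
  assumes cont: "continuous_on {0..} F"
    and semigroup: "\<And>s t. 0 \<le> s \<Longrightarrow> 0 \<le> t \<Longrightarrow> F (s + t) = F s ** F t"
    and lim: "(F \<longlongrightarrow> 0) at_top"
  obtains D a where "0 < a" "\<And>t. 0 \<le> t \<Longrightarrow> norm (F t) \<le> D * exp (- a * t)"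
proof -
  obtain K where K: "0 < K"
    "\<And>(X :: real^'n^'n) (Y :: real^'n^'n). norm (X ** Y) \<le> norm X * norm Y * K"
    using matrix_mult.pos_bounded by blast
  \<comment> \<open>Dividing by \<open>K\<close> compensates for the constant in the norm bound for
    products.\<close>
  have "eventually (\<lambda>t. norm (F t) < exp (- 1) / K) at_top"
    using tendstoD[OF lim, of "exp (- 1) / K"] K(1) by simp
  then have "eventually (\<lambda>t. norm (F t) < exp (- 1) / K \<and> 0 < t) at_top"
    by (intro eventually_conj eventually_gt_at_top)
  then obtain T where T: "norm (F T) < exp (- 1) / K" "0 < T"
    by (auto dest: eventually_happens)
  have "compact (F ` {0..T})"
    by (intro compact_continuous_image continuous_on_subset[OF cont]) auto
  then have "\<exists>D. \<forall>t\<in>{0..T}. norm (F t) \<le> D"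
    by (auto dest!: compact_imp_bounded simp: bounded_iff)
  then obtain D where D: "\<And>t. 0 \<le> t \<Longrightarrow> t \<le> T \<Longrightarrow> norm (F t) \<le> D"
    by (meson atLeastAtMost_iff)
  have step: "norm (F (real n * T + t)) \<le> D * exp (- real n)" if "0 \<le> t" "t \<le> T" for n t
  proof (induction n)
    case (Suc n)
    have "F (real (Suc n) * T + t) = F (T + (real n * T + t))"
      by (simp add: algebra_simps)
    also have "\<dots> = F T ** F (real n * T + t)"
      using T that by (intro semigroup) auto
    finally have "norm (F (real (Suc n) * T + t)) \<le> (norm (F T) * K) * norm (F (real n * T + t))"
      using K(2)[of "F T" "F (real n * T + t)"] by (simp add: mult_ac)
    also have "\<dots> \<le> exp (- 1) * (D * exp (- real n))"
      using T K(1) Suc by (intro mult_mono) (auto simp: field_simps)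
    finally show ?case by (simp add: exp_diff exp_minus field_simps exp_add)
  qed (use D that in simp)
  \<comment> \<open>Rounding \<open>t / T\<close> down to \<open>n\<close> loses at most one step,
    which the factor \<open>exp 1\<close> pays for. \<open>D\<close> is nonnegative because it
    bounds \<open>norm (F 0)\<close>.\<close>
  have "norm (F t) \<le> (D * exp 1) * exp (- (1 / T) * t)" if "0 \<le> t" for t
  proof -
    define n where "n = nat \<lfloor>t / T\<rfloor>"
    have n: "real n \<le> t / T" "t / T \<le> real n + 1"
      using that T by (auto simp: n_def)
    have "norm (F t) = norm (F (real n * T + (t - real n * T)))" by simp
    also have "\<dots> \<le> D * exp (- real n)"
      using n T by (intro step) (auto simp: field_simps)
    also have "\<dots> \<le> D * exp (1 - t / T)"
      using n order_trans[OF norm_ge_zero D[of 0]] T by (intro mult_left_mono) auto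
    finally show ?thesis by (simp add: exp_diff exp_minus field_simps)
  qed
  with T that[of "1 / T" "D * exp 1"] show ?thesis by simp
qed

text \<open>Dominated convergence for the truncations of \<open>f\<close> to
  \<open>{0..real k}\<close>. The second conclusion carries identities on compact intervals over to
  the half-line.\<close>

lemma integral_half_line_dominated:
  fixes f :: "real \<Rightarrow> 'a::euclidean_space"
  assumes cont: "continuous_on {0..} f"
    and h: "h integrable_on {0..}"
    and le: "\<And>t. 0 \<le> t \<Longrightarrow> norm (f t) \<le> h t"
  shows "f integrable_on {0..}"
    and "(\<lambda>k. integral {0..real k} f) \<longlonglongrightarrow> integral {0..} f"
proof -
  define g where "g k t = (if t \<in> {0..real k} then f t else 0)" for k t
  have sub: "{0..real k} \<inter> {0..} = {0..real k}" for k by auto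
  have int: "g k integrable_on {0..}" and eq: "integral {0..} (g k) = integral {0..real k} f" for k
    using integrable_continuous_real[OF continuous_on_subset[OF cont, of "{0..real k}"]]
    unfolding g_def by (simp_all only: integrable_restrict_Int integral_restrict_Int sub) auto
  have norm_g: "norm (g k t) \<le> h t" if "t \<in> {0..}" for k t
    using le[of t] that order_trans[OF norm_ge_zero le[of t]] by (auto simp: g_def)
  have conv: "(\<lambda>k. g k t) \<longlonglongrightarrow> f t" if "t \<in> {0..}" for t
  proof (rule tendsto_eventually)
    show "\<forall>\<^sub>F k in sequentially. g k t = f t"
      by (rule eventually_mono[OF eventually_ge_at_top[of "nat \<lceil>t\<rceil>"]])
         (use that in \<open>auto simp: g_def\<close>)
  qed
  show "f integrable_on {0..}" "(\<lambda>k. integral {0..real k} f) \<longlonglongrightarrow> integral {0..} f"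
    using dominated_convergence[OF int h norm_g conv] by (simp_all add: eq)
qed

section \<open>The Gramian equations\<close>

text \<open>The columns of the exponential are the free trajectories started at the basis vectors,
  so semistability makes each of them converge. Hence the \<open>Lim\<close> in
  \<open>limit_matrix\<close> is a true limit.\<close>

lemma semistable_matrix_exp_tendsto:
  fixes A :: "real^'n^'n" and B :: "real^'p^'n"
  assumes "semistable A B"
  shows "((\<lambda>t. matrix_exp (t *\<^sub>R A)) \<longlongrightarrow> limit_matrix A) at_top"
proof -
  have "\<exists>l. ((\<lambda>t. matrix_exp (t *\<^sub>R A) *v x0) \<longlongrightarrow> l) at_top" for x0
  proof -
    have "((\<lambda>t. matrix_exp (t *\<^sub>R A) *v x0) has_vector_derivative
        (A ** matrix_exp (t *\<^sub>R A)) *v x0) (at t within {0..})" for t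
      by (intro bounded_linear.has_vector_derivative[OF _ has_vector_derivative_matrix_exp]
          linear_conv_bounded_linear[THEN iffD1] linearI)
         (simp_all add: matrix_vector_mult_add_rdistrib scaleR_matrix_vector_assoc)
    then have "state_trajectory A B (\<lambda>_. 0) (\<lambda>t. matrix_exp (t *\<^sub>R A) *v x0)"
      by (simp add: state_trajectory_def matrix_vector_mul_assoc)
    with assms show ?thesis unfolding semistable_def by blast
  qed
  then obtain l where l: "\<And>x0. ((\<lambda>t. matrix_exp (t *\<^sub>R A) *v x0) \<longlongrightarrow> l x0) at_top"
    by metis
  have "((\<lambda>t. matrix_exp (t *\<^sub>R A)) \<longlongrightarrow> (\<chi> i j. l (axis j 1) $ i)) at_top"
    using tendsto_vec_nth[OF l[of "axis _ 1"]]
    by (intro vec_tendstoI) (simp add: matrix_vector_mult_basis column_def)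
  then show ?thesis
    by (simp add: limit_matrix_def tendsto_Lim)
qed

section \<open>The limit projection and the transient part of the exponential\<close>

context
  fixes A J :: "real^'n^'n"
  assumes exp_tendsto: "((\<lambda>t. matrix_exp (t *\<^sub>R A)) \<longlongrightarrow> J) at_top"
begin

text \<open>Transposition is continuous. This limit puts the transposed system under the same
  assumption, so that every consequence is available for it too.\<close>

lemma exp_transpose_tendsto: "((\<lambda>t. matrix_exp (t *\<^sub>R transpose A)) \<longlongrightarrow> transpose J) at_top"
  using bounded_linear.tendsto[OF bounded_linear_transpose exp_tendsto]
  by (simp add: matrix_exp_transpose flip: transpose_scalar)

text \<open>Shifting time by \<open>s\<close> does not change the limit, while the addition law
  splits off the factor at \<open>s\<close> on either side.\<close>

lemma matrix_exp_limit: "matrix_exp (s *\<^sub>R A) ** J = J" "J ** matrix_exp (s *\<^sub>R A) = J"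
proof -
  have shift: "((\<lambda>t. matrix_exp ((s + t) *\<^sub>R A)) \<longlongrightarrow> J) at_top"
    by (rule filterlim_compose[OF exp_tendsto])
       (intro filterlim_tendsto_add_at_top[OF tendsto_const] filterlim_ident)
  have "((\<lambda>t. matrix_exp ((s + t) *\<^sub>R A)) \<longlongrightarrow> matrix_exp (s *\<^sub>R A) ** J) at_top"
    unfolding matrix_exp_add by (intro matrix_mult.tendsto tendsto_const exp_tendsto)
  with shift show "matrix_exp (s *\<^sub>R A) ** J = J"
    using tendsto_unique trivial_limit_at_top_linorder by blast
  have "((\<lambda>t. matrix_exp ((s + t) *\<^sub>R A)) \<longlongrightarrow> J ** matrix_exp (s *\<^sub>R A)) at_top"
    unfolding add.commute[of s] matrix_exp_add by (intro matrix_mult.tendsto tendsto_const exp_tendsto)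
  with shift show "J ** matrix_exp (s *\<^sub>R A) = J"
    using tendsto_unique trivial_limit_at_top_linorder by blast
qed

text \<open>Time tends to infinity in the absorption law just shown.\<close>

lemma limit_idempotent: "J ** J = J"
proof -
  have "((\<lambda>t. matrix_exp (t *\<^sub>R A) ** J) \<longlongrightarrow> J ** J) at_top"
    by (intro matrix_mult.tendsto tendsto_const exp_tendsto)
  then show ?thesis by (simp add: matrix_exp_limit tendsto_const_iff)
qed

text \<open>The product of the exponential with \<open>J\<close> is constant in time; its derivative
  at \<open>0\<close> is \<open>A ** J\<close>.\<close>

lemma mult_limit_eq_0: "A ** J = 0"
proof -
  have "((\<lambda>t. matrix_exp (t *\<^sub>R A) ** J) has_vector_derivative
      (A ** matrix_exp (0 *\<^sub>R A)) ** J) (at 0)"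
    by (rule bounded_linear.has_vector_derivative[OF matrix_mult.bounded_linear_left
          has_vector_derivative_matrix_exp])
  then have "((\<lambda>t::real. J) has_vector_derivative A ** J) (at 0)"
    by (simp add: matrix_exp_limit matrix_exp_0)
  then show ?thesis
    by (rule vector_derivative_unique_at) (rule has_vector_derivative_const)
qed

lemma transient_exponential_decay:
  obtains D a where "0 < a"
    "\<And>t. 0 \<le> t \<Longrightarrow> norm (matrix_exp (t *\<^sub>R A) - J) \<le> D * exp (- a * t)"
proof (rule matrix_semigroup_exponential_decay[of "\<lambda>t. matrix_exp (t *\<^sub>R A) - J"])
  show "continuous_on {0..} (\<lambda>t. matrix_exp (t *\<^sub>R A) - J)"
    by (intro continuous_intros continuous_on_matrix_exp)
  \<comment> \<open>On expanding the right side, both mixed products and \<open>J ** J\<close> equal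
    \<open>J\<close>, which leaves a single \<open>- J\<close>.\<close>
  show "matrix_exp ((s + t) *\<^sub>R A) - J
      = (matrix_exp (s *\<^sub>R A) - J) ** (matrix_exp (t *\<^sub>R A) - J)" for s t
    by (simp add: matrix_exp_add matrix_mult.diff_left matrix_mult.diff_right matrix_exp_limit
        limit_idempotent)
  show "((\<lambda>t. matrix_exp (t *\<^sub>R A) - J) \<longlongrightarrow> 0) at_top"
    using exp_tendsto by (simp add: LIM_zero)
qed (rule that)

end

section \<open>Uniqueness and existence for the controllability equations\<close>

lemma controllability_equations_unique:
  assumes lim: "((\<lambda>t. matrix_exp (t *\<^sub>R A)) \<longlongrightarrow> J) at_top"
    and X: "controllability_equations A B J X" and Y: "controllability_equations A B J Y"
  shows "X = Y"
proof -
  define D where "D = X - Y"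
  have Lyapunov: "A ** D + D ** transpose A = 0" and JDJ: "J ** D ** transpose J = 0"
    using X Y unfolding controllability_equations_def D_def
    by (simp_all add: matrix_mult.diff_left matrix_mult.diff_right algebra_simps)
  define g where "g t = matrix_exp (t *\<^sub>R A) ** D ** matrix_exp (t *\<^sub>R transpose A)" for t
  have "(g has_vector_derivative 0) (at t)" for t
  proof -
    have "(g has_vector_derivative matrix_exp (t *\<^sub>R A) ** D ** (transpose A ** matrix_exp (t *\<^sub>R transpose A))
        + A ** matrix_exp (t *\<^sub>R A) ** D ** matrix_exp (t *\<^sub>R transpose A)) (at t)"
      unfolding g_def
      by (intro matrix_mult.has_vector_derivative has_vector_derivative_matrix_exp
          bounded_linear.has_vector_derivative[OF matrix_mult.bounded_linear_left])
    \<comment> \<open>Commuting \<open>A\<close> past its exponential brings it next to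
      \<open>D\<close>, where the homogeneous Lyapunov equation applies.\<close>
    also have "matrix_exp (t *\<^sub>R A) ** D ** (transpose A ** matrix_exp (t *\<^sub>R transpose A))
        + A ** matrix_exp (t *\<^sub>R A) ** D ** matrix_exp (t *\<^sub>R transpose A)
      = matrix_exp (t *\<^sub>R A) ** (A ** D + D ** transpose A) ** matrix_exp (t *\<^sub>R transpose A)"
      by (simp add: matrix_mult.add_left matrix_mult.add_right matrix_mul_assoc
          flip: matrix_exp_commute[of t A])
    finally show ?thesis by (simp add: Lyapunov)
  qed
  then obtain c where c: "\<And>t. g t = c"
    using has_vector_derivative_zero_constant[of UNIV g] by auto
  have "(g \<longlongrightarrow> J ** D ** transpose J) at_top"
    unfolding g_def by (intro matrix_mult.tendsto tendsto_const lim exp_transpose_tendsto)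
  moreover have "g = (\<lambda>_. c)" using c by blast
  ultimately have "c = 0" by (simp add: JDJ tendsto_const_iff)
  then show ?thesis using c[of 0] by (simp add: g_def matrix_exp_0 D_def)
qed

text \<open>Stated for any limit \<open>J\<close> and with the integral written out, so that the
  transposed data can be substituted to treat \<open>Q\<close>.\<close>

lemma gramian_solves_controllability_equations:
  fixes A J P :: "real^'n^'n" and B :: "real^'p^'n"
  assumes lim: "((\<lambda>t. matrix_exp (t *\<^sub>R A)) \<longlongrightarrow> J) at_top"
    and P: "P = integral {0..} (\<lambda>t::real. (matrix_exp (t *\<^sub>R A) - J) ** B ** transpose B **
      (matrix_exp (t *\<^sub>R transpose A) - transpose J))"
  shows "transpose P = P" "controllability_equations A B J P"
proof -
  define F where "F t = matrix_exp (t *\<^sub>R A) - J" for t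
  have F_transpose: "matrix_exp (t *\<^sub>R transpose A) - transpose J = transpose (F t)" for t
    by (simp add: F_def transpose_diff matrix_exp_transpose flip: transpose_scalar)
  define M where "M t = F t ** (B ** transpose B) ** transpose (F t)" for t
  have P_M: "P = integral {0..} M"
    by (simp add: P F_transpose F_def[symmetric] M_def[abs_def] matrix_mul_assoc)
  have contF: "continuous_on S F" for S
    unfolding F_def by (intro continuous_intros continuous_on_matrix_exp)
  have contM: "continuous_on S M" for S
    unfolding M_def
    by (intro matrix_mult.continuous_on contF continuous_on_const
        bounded_linear.continuous_on[OF bounded_linear_transpose])
  obtain D a where a: "0 < a" and D: "\<And>t. 0 \<le> t \<Longrightarrow> norm (F t) \<le> D * exp (- a * t)"
    using transient_exponential_decay[OF lim] unfolding F_def by blast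
  obtain K where K: "0 < K"
    "\<And>(X :: real^'n^'n) (Y :: real^'n^'n). norm (X ** Y) \<le> norm X * norm Y * K"
    using matrix_mult.pos_bounded by blast
  obtain L where L: "0 < L" "\<And>X :: real^'n^'n. norm (transpose X) \<le> norm X * L"
    using bounded_linear.pos_bounded[OF bounded_linear_transpose] by blast
  define W where "W = B ** transpose B"
  \<comment> \<open>One \<open>K\<close> for each of the two products, \<open>L\<close> for the
    transposition, and \<open>D\<close> twice for the two factors \<open>F t\<close>, whose decay
    rates add up to \<open>2 * a\<close>.\<close>
  define N where "N = norm W * K * L * K * (D * D)"
  have "norm (M t) \<le> N * exp (- (2 * a) * t)" if "0 \<le> t" for t
  proof -
    have "norm (M t) \<le> norm (F t ** W) * norm (transpose (F t)) * K"
      unfolding M_def W_def by (rule K)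
    also have "\<dots> \<le> (norm (F t) * norm W * K) * (norm (F t) * L) * K"
      using K L by (intro mult_right_mono mult_mono) auto
    also have "\<dots> = (norm W * K * L * K) * (norm (F t) * norm (F t))" by (simp add: mult_ac)
    also have "\<dots> \<le> (norm W * K * L * K) * ((D * exp (- a * t)) * (D * exp (- a * t)))"
      using K L D[OF that] by (intro mult_left_mono mult_mono') auto
    also have "\<dots> = N * (exp (- a * t) * exp (- a * t))" by (simp add: N_def mult_ac)
    also have "exp (- a * t) * exp (- a * t) = exp (- (2 * a) * t)"
      by (simp flip: exp_add)
    finally show ?thesis .
  qed
  moreover have "(\<lambda>t. N * exp (- (2 * a) * t)) integrable_on {0..}"
    using integrable_on_exp_minus_to_infinity[of "2 * a" 0] a
    by (intro integrable_on_mult_right) simp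
  ultimately have intM: "M integrable_on {0..}"
    and limM: "(\<lambda>k. integral {0..real k} M) \<longlonglongrightarrow> P"
    unfolding P_M using integral_half_line_dominated[OF contM] by blast+

  \<comment> \<open>Transposition commutes with the integral, and each \<open>M t\<close> is
    symmetric.\<close>
  have "transpose P = integral {0..} (\<lambda>t. transpose (M t))"
    using integral_linear[OF intM bounded_linear_transpose] by (simp add: P_M o_def)
  then show "transpose P = P"
    by (simp add: P_M M_def[abs_def] matrix_transpose_mul matrix_mul_assoc)

  \<comment> \<open>The integrand already vanishes pointwise, since
    \<open>J ** F t = J - J ** J = 0\<close>.\<close>
  have "((\<lambda>X. J ** X ** transpose J) \<circ> M) = (\<lambda>_. 0)"
    using limit_idempotent[OF lim] matrix_exp_limit[OF lim]
    by (auto simp: M_def matrix_mul_assoc F_def matrix_mult.diff_right)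
  moreover have "bounded_linear (\<lambda>X. J ** X ** transpose J)"
    using bounded_linear_compose[OF matrix_mult.bounded_linear_left matrix_mult.bounded_linear_right] .
  ultimately have JPJ: "J ** P ** transpose J = 0"
    using integral_linear[OF intM, of "\<lambda>X. J ** X ** transpose J"] by (simp add: P_M)

  \<comment> \<open>The derivative of \<open>F\<close> is \<open>A\<close> times the full
    exponential; \<open>A ** J = 0\<close> turns it into \<open>A ** F t\<close>, so that
    \<open>M\<close> satisfies a closed linear equation.\<close>
  have AF: "A ** F t = A ** matrix_exp (t *\<^sub>R A)" for t
    by (simp add: F_def matrix_mult.diff_right mult_limit_eq_0[OF lim])
  \<comment> \<open>The Lyapunov operator; as a bounded linear map it passes through integrals and
    limits.\<close>
  define G where "G X = A ** X + X ** transpose A" for X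
  have G: "bounded_linear G"
    unfolding G_def
    by (intro bounded_linear_add matrix_mult.bounded_linear_left matrix_mult.bounded_linear_right)
  have derivF: "(F has_vector_derivative A ** F t) (at t within S)" for t S
    unfolding AF unfolding F_def
    using has_vector_derivative_diff[OF has_vector_derivative_matrix_exp has_vector_derivative_const]
    by simp
  have derivM: "(M has_vector_derivative G (M t)) (at t within S)" for t S
  proof -
    have "(M has_vector_derivative F t ** W ** transpose (A ** F t)
        + A ** F t ** W ** transpose (F t)) (at t within S)"
      unfolding M_def W_def[symmetric]
      by (intro matrix_mult.has_vector_derivative derivF
          bounded_linear.has_vector_derivative[OF matrix_mult.bounded_linear_left]
          bounded_linear.has_vector_derivative[OF bounded_linear_transpose])
    then show ?thesis
      by (simp add: G_def M_def W_def matrix_transpose_mul matrix_mul_assoc add.commute)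
  qed
  have "G (integral {0..real k} M) = M (real k) - M 0" for k
  proof -
    have "((G \<circ> M) has_integral M (real k) - M 0) {0..real k}"
      unfolding o_def by (intro fundamental_theorem_of_calculus derivM) simp
    then show ?thesis
      using integral_linear[OF integrable_continuous_real[OF contM] G, of 0 "real k"]
      by (simp add: integral_unique)
  qed
  moreover have "(\<lambda>k. G (integral {0..real k} M)) \<longlonglongrightarrow> G P"
    by (rule bounded_linear.tendsto[OF G limM])
  \<comment> \<open>Decay removes the upper boundary term; the remaining \<open>M 0\<close> is the
    constant term of the Lyapunov equation.\<close>
  moreover have "(\<lambda>k. M (real k) - M 0) \<longlonglongrightarrow> 0 - M 0"
  proof -
    have "(F \<longlongrightarrow> 0) at_top"
      using lim unfolding F_def by (rule LIM_zero)
    then have "(M \<longlongrightarrow> 0 ** (B ** transpose B) ** transpose 0) at_top"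
      unfolding M_def
      by (intro matrix_mult.tendsto tendsto_const bounded_linear.tendsto[OF bounded_linear_transpose])
    then have "(M \<longlongrightarrow> 0) at_top" by simp
    then show ?thesis
      by (intro tendsto_diff tendsto_const filterlim_compose[OF _ filterlim_real_sequentially])
  qed
  ultimately have "G P = - M 0"
    using LIMSEQ_unique by fastforce
  moreover have "M 0 = (mat 1 - J) ** B ** transpose B ** (mat 1 - transpose J)"
    by (simp add: M_def F_def matrix_exp_0 matrix_mul_assoc transpose_diff)
  ultimately show "controllability_equations A B J P"
    using JPJ by (simp add: controllability_equations_def G_def)
qed

text \<open>Duality: \<open>transpose C\<close> takes the role of the input matrix, and double
  transposes cancel.\<close>

lemma observability_equations_iff_controllability_equations:
  "observability_equations A C J X
    \<longleftrightarrow> controllability_equations (transpose A) (transpose C) (transpose J) X"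
  by (simp add: observability_equations_def controllability_equations_def)

theorem theorem1:
  fixes A :: "real^'n^'n" and B :: "real^'p^'n" and C :: "real^'n^'q"
    and J P Q :: "real^'n^'n"
  assumes "semistable A B"
    and "J = limit_matrix A"
    and "P = pseudo_controllability_gramian A B"
    and "Q = pseudo_observability_gramian A C"
  shows "(transpose P = P \<and> controllability_equations A B J P \<and>
          (\<forall>X. transpose X = X \<and> controllability_equations A B J X \<longrightarrow> X = P)) \<and>
         (transpose Q = Q \<and> observability_equations A C J Q \<and>
          (\<forall>X. transpose X = X \<and> observability_equations A C J X \<longrightarrow> X = Q))"
proof -
  have lim: "((\<lambda>t. matrix_exp (t *\<^sub>R A)) \<longlongrightarrow> J) at_top"
    using semistable_matrix_exp_tendsto[OF assms(1)] assms(2) by simp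
  note lim_T = exp_transpose_tendsto[OF lim]
  note P = gramian_solves_controllability_equations
    [OF lim assms(3)[unfolded pseudo_controllability_gramian_def, folded assms(2)]]
  \<comment> \<open>Double transposes are inserted so that \<open>Q\<close> has the form of the
    controllability integral of the transposed system.\<close>
  have "Q = integral {0..} (\<lambda>t::real. (matrix_exp (t *\<^sub>R transpose A) - transpose J) ** transpose C **
      transpose (transpose C) ** (matrix_exp (t *\<^sub>R transpose (transpose A)) - transpose (transpose J)))"
    by (simp add: assms(2,4) pseudo_observability_gramian_def)
  note Q = gramian_solves_controllability_equations[OF lim_T this]
  show ?thesis
    unfolding observability_equations_iff_controllability_equations
    using P Q controllability_equations_unique[OF lim] controllability_equations_unique[OF lim_T]
    by blast
qed

end
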